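(* Let $k$ be a field of characteristic $0$ and let $(A,+,\cdot,\Sigma)$ be a summability algebra over $k$ with evaluations, with maximal ideal $\mathfrak{m}$. Then for all $\delta_1,\delta_2\in\mathfrak{m}$ we have $\exp(\delta_1)\cdot\exp(\delta_2)=\exp(\delta_1\ast\delta_2)$.
   Context: Vector spaces and algebras are over $k$; algebras are associative, not necessarily commutative. $V^I$ is the space of maps $I\to V$, $V^{(I)}$ the subspace of maps with finite support. Summability spaces. A summability structure $\Sigma$ on a vector space $V$ consists, for every set $I$, of a linear subspace $\mathrm{dom}\,\Sigma_I\subseteq V^I$ (the summable families) and a linear map $\Sigma_I\colon \mathrm{dom}\,\Sigma_I\to V$ (also written $\sum_{i\in I}\mathbf{v}(i)$), such that for all sets $I,J$: (SS1) $V^{(I)}\subseteq \mathrm{dom}\,\Sigma_I$ and $\Sigma_I\mathbf{v}$ is the usual finite sum for $\mathbf{v}\in V^{(I)}$; (SS2) if $\varphi\colon I\to J$ is bijective and $\mathbf{v}\in\mathrm{dom}\,\Sigma_J$, then $\mathbf{v}\circ\varphi\in\mathrm{dom}\,\Sigma_I$ and $\Sigma_I(\mathbf{v}\circ\varphi)=\Sigma_J\mathbf{v}$; (SS3) if $I=\bigsqcup_{j\in J}I_j$ and $\mathbf{v}\in\mathrm{dom}\,\Sigma_I$, then $\mathbf{v}|_{I_j}\in\mathrm{dom}\,\Sigma_{I_j}$ for all $j$, $(\Sigma_{I_j}\mathbf{v}|_{I_j})_{j\in J}\in\mathrm{dom}\,\Sigma_J$ and $\Sigma_I\mathbf{v}=\Sigma_J\big((\Sigma_{I_j}\mathbf{v}|_{I_j})_{j\in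 J}\big)$; (SS4) if $I=I_1\sqcup I_2$, $\mathbf{v}\in\mathrm{dom}\,\Sigma_{I_1}$, $\mathbf{w}\in\mathrm{dom}\,\Sigma_{I_2}$, then the family on $I$ restricting to $\mathbf{v}$ on $I_1$ and to $\mathbf{w}$ on $I_2$ lies in $\mathrm{dom}\,\Sigma_I$. $(V,\Sigma)$ is ultrafinite if moreover (UF): for every $\mathbf{v}\in\mathrm{dom}\,\Sigma_I$ and every family $(f_i\colon X_i\to k)_{i\in I}$ with each $X_i$ finite, the family $(f_i(x)\mathbf{v}(i))_{i\in I,\,x\in X_i}$ is summable. A subspace $W$ is closed if sums of summable families of elements of $W$ lie in $W$. A closed ideal is a two-sided ideal that is a closed subspace. A summability algebra is an algebra $A$ with a summability structure such that for $\mathbf{a}\in\mathrm{dom}\,\Sigma_I$, $\mathbf{b}\in\mathrm{dom}\,\Sigma_J$ the family $(\mathbf{a}(i)\cdot\mathbf{b}(j))_{(i,j)\in I\times J}$ is summable with sum $(\Sigma_I\mathbf{a})\cdot(\Sigma_J\mathbf{b})$. Evaluations. $J^\star=\bigcup_{n\in\mathbb{N}}J^n$ is the set of finite words over $J$ (including the empty word). A unital ultrafinite summability algebra $A$ has evaluations if there is a closed ideal $\mathfrak{m}$ of $A$ with $A=k1_A+\mathfrak{m}$ such that for every set $J$ and every summable family $\mathbf{f}\colon J\to\mathfrak{m}$, the family $(\mathbf{f}(\theta_1)\cdots\mathbf{f}(\theta_n))_{(\theta_1,\dots,\theta_n)\in J^\star}$ is summable in $A$ (empty product $=1_A$). This $\mathfrak{m}$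 is the maximal ideal referred to in the claim. For $\delta\in\mathfrak{m}$, $\exp(\delta)=\sum_{n\ge0}\frac{1}{n!}\delta^n$. Let $X_0\ast X_1=\sum_{n\ge1}\frac{(-1)^{n+1}}{n}\sum \frac{1}{m_1!p_1!\cdots m_n!p_n!}X_0^{m_1}X_1^{p_1}\cdots X_0^{m_n}X_1^{p_n}$, a formal power series over $k$ in non-commuting variables, where the inner sum is over all $(m_1,p_1),\dots,(m_n,p_n)\in\mathbb{N}^2$ with $m_i+p_i\ge1$ for all $i$. Writing $P(\theta)$ for the coefficient in $X_0\ast X_1$ of the word $\theta\in\{0,1\}^\star$, define for $\delta_1,\delta_2\in\mathfrak{m}$: $\delta_1\ast\delta_2=\sum_{\theta=(\theta_1,\dots,\theta_n)\in\{0,1\}^\star}P(\theta)\,\delta_{\theta_1+1}\cdots\delta_{\theta_n+1}\in\mathfrak{m}$ (that is, $X_0$ is evaluated at $\delta_1$ and $X_1$ at $\delta_2$). *)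

theory Defs
  imports Complex_Main "HOL-Library.Disjoint_Sets" "HOL-Library.Infinite_Typeclass"
begin

text \<open>
  A summability structure assigns to every set \<open>I\<close> a partial map from families \<open>I \<rightarrow> V\<close> to \<open>V\<close>.
  Here the index sets \<open>I\<close> are the subsets of an arbitrary infinite type \<open>'i\<close>, and
  \<open>S I :: ('i \<Rightarrow> 'v) \<Rightarrow> 'v option\<close> is the partial map, so that \<open>dom (S I)\<close> is the
  set of summable families and \<open>the (S I v)\<close> the sum. A family on \<open>I\<close> is a total function of which
  only the values on \<open>I\<close> matter (axiom \<open>family_cong\<close>).

  Restricting a structure defined on all sets to the subsets of \<open>'i\<close> loses nothing for what follows:
  bijection invariance determines it on all sets that embed into \<open>'i\<close>, and these include all
  countable sets and are closed under products, finite words and disjoint unions indexed by such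
  sets. Conversely, a structure on the subsets of \<open>'i\<close> extends to all sets: a family on a
  larger set is summable iff its support embeds into \<open>'i\<close> and the restriction to the support is
  summable.
\<close>

text \<open>
  The value of the structure on a family indexed by a set of another type, moved into \<open>'i\<close> along an
  injection. The choice of the injection is irrelevant, see \<open>transport_eq\<close> below.
\<close>

definition transport ::
    "('i set \<Rightarrow> ('i \<Rightarrow> 'v) \<Rightarrow> 'v option) \<Rightarrow> 'b set \<Rightarrow> ('b \<Rightarrow> 'v) \<Rightarrow> 'v option" where
  "transport S K v =
     (if \<exists>\<phi> :: 'b \<Rightarrow> 'i. inj_on \<phi> K
      then let \<phi> = (SOME \<phi> :: 'b \<Rightarrow> 'i. inj_on \<phi> K) in S (\<phi> ` K) (v \<circ> inv_into K \<phi>)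
      else None)"

definition summable_over ::
    "('i set \<Rightarrow> ('i \<Rightarrow> 'v) \<Rightarrow> 'v option) \<Rightarrow> 'b set \<Rightarrow> ('b \<Rightarrow> 'v) \<Rightarrow> bool" where
  "summable_over S K v \<longleftrightarrow> v \<in> dom (transport S K)"

definition sum_over ::
    "('i set \<Rightarrow> ('i \<Rightarrow> 'v) \<Rightarrow> 'v option) \<Rightarrow> 'b set \<Rightarrow> ('b \<Rightarrow> 'v) \<Rightarrow> 'v" where
  "sum_over S K v = the (transport S K v)"


locale summability_space = vector_space scale
  for scale :: "'k::field \<Rightarrow> 'v::ab_group_add \<Rightarrow> 'v" (infixr \<open>*s\<close> 75) +
  fixes S :: "'i::infinite set \<Rightarrow> ('i \<Rightarrow> 'v) \<Rightarrow> 'v option"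
  assumes family_cong: "(\<And>i. i \<in> I \<Longrightarrow> v i = w i) \<Longrightarrow> S I v = S I w"
    and dom_add: "v \<in> dom (S I) \<Longrightarrow> w \<in> dom (S I) \<Longrightarrow> (\<lambda>i. v i + w i) \<in> dom (S I)"
    and sum_add: "v \<in> dom (S I) \<Longrightarrow> w \<in> dom (S I) \<Longrightarrow>
      the (S I (\<lambda>i. v i + w i)) = the (S I v) + the (S I w)"
    and dom_scale: "v \<in> dom (S I) \<Longrightarrow> (\<lambda>i. c *s v i) \<in> dom (S I)"
    and sum_scale: "v \<in> dom (S I) \<Longrightarrow> the (S I (\<lambda>i. c *s v i)) = c *s the (S I v)"
    and SS1: "finite {i \<in> I. v i \<noteq> 0} \<Longrightarrow> S I v = Some (\<Sum>i\<in>{i \<in> I. v i \<noteq> 0}. v i)"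
    and SS2_dom: "bij_betw \<phi> I J \<Longrightarrow> v \<in> dom (S J) \<Longrightarrow> v \<circ> \<phi> \<in> dom (S I)"
    and SS2_sum: "bij_betw \<phi> I J \<Longrightarrow> v \<in> dom (S J) \<Longrightarrow> the (S I (v \<circ> \<phi>)) = the (S J v)"
    and SS3_parts: "disjoint_family_on B J \<Longrightarrow> I = (\<Union>j\<in>J. B j) \<Longrightarrow> v \<in> dom (S I) \<Longrightarrow>
      j \<in> J \<Longrightarrow> v \<in> dom (S (B j))"
    and SS3_dom: "disjoint_family_on B J \<Longrightarrow> I = (\<Union>j\<in>J. B j) \<Longrightarrow> v \<in> dom (S I) \<Longrightarrow>
      (\<lambda>j. the (S (B j) v)) \<in> dom (S J)"
    and SS3_sum: "disjoint_family_on B J \<Longrightarrow> I = (\<Union>j\<in>J. B j) \<Longrightarrow> v \<in> dom (S I) \<Longrightarrow>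
      the (S I v) = the (S J (\<lambda>j. the (S (B j) v)))"
    and SS4: "I1 \<inter> I2 = {} \<Longrightarrow> v \<in> dom (S I1) \<Longrightarrow> w \<in> dom (S I2) \<Longrightarrow>
      (\<lambda>i. if i \<in> I1 then v i else w i) \<in> dom (S (I1 \<union> I2))"
begin

definition closed_subspace :: "'v set \<Rightarrow> bool" where
  "closed_subspace W \<longleftrightarrow>
     subspace W \<and> (\<forall>I. \<forall>v \<in> dom (S I). (\<forall>i\<in>I. v i \<in> W) \<longrightarrow> the (S I v) \<in> W)"

lemma SS2_eq:
  assumes "bij_betw \<phi> I J"
  shows "S I (v \<circ> \<phi>) = S J v"
proof (cases "v \<in> dom (S J)")
  case True
  then show ?thesis
    using SS2_dom[OF assms True] SS2_sum[OF assms True] by (auto simp: dom_def)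
next
  case False
  have inv: "bij_betw (inv_into I \<phi>) J I"
    by (rule bij_betw_inv_into[OF assms])
  have eq: "S J ((v \<circ> \<phi>) \<circ> inv_into I \<phi>) = S J v"
    by (rule family_cong) (use assms in \<open>auto simp: bij_betw_inv_into_right\<close>)
  have "v \<circ> \<phi> \<notin> dom (S I)"
    using SS2_dom[OF inv, of "v \<circ> \<phi>"] False eq by (metis domIff)
  with False show ?thesis by (simp add: domIff)
qed

lemma transport_eq:
  fixes \<phi> :: "'b \<Rightarrow> 'i"
  assumes "inj_on \<phi> K"
  shows "transport S K v = S (\<phi> ` K) (v \<circ> inv_into K \<phi>)"
proof -
  define \<psi> where "\<psi> = (SOME \<psi> :: 'b \<Rightarrow> 'i. inj_on \<psi> K)"
  have \<psi>: "inj_on \<psi> K"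
    unfolding \<psi>_def using someI[of "\<lambda>\<psi>. inj_on \<psi> K", OF assms] .
  have "bij_betw (inv_into K \<phi>) (\<phi> ` K) K"
    using assms by (simp add: bij_betw_inv_into inj_on_imp_bij_betw)
  then have bij: "bij_betw (\<psi> \<circ> inv_into K \<phi>) (\<phi> ` K) (\<psi> ` K)"
    using \<psi> by (auto intro: bij_betw_trans inj_on_imp_bij_betw)
  have "transport S K v = S (\<psi> ` K) (v \<circ> inv_into K \<psi>)"
    using assms unfolding transport_def \<psi>_def Let_def by auto
  also have "\<dots> = S (\<phi> ` K) ((v \<circ> inv_into K \<psi>) \<circ> (\<psi> \<circ> inv_into K \<phi>))"
    by (rule SS2_eq[OF bij, symmetric])
  also have "\<dots> = S (\<phi> ` K) (v \<circ> inv_into K \<phi>)"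
    by (rule family_cong) (use assms \<psi> in \<open>auto simp: inv_into_f_f\<close>)
  finally show ?thesis .
qed

lemma transport_same_type: "transport S I v = S I v" for I :: "'i set"
proof -
  have "transport S I v = S (id ` I) (v \<circ> inv_into I id)"
    by (rule transport_eq) simp
  also have "\<dots> = S (id ` I) v"
    by (rule family_cong) (metis comp_apply id_apply inj_on_id inv_into_f_f image_id)
  finally show ?thesis by simp
qed

end


text \<open>
  The finite sets \<open>X i\<close> may be taken inside \<open>'i\<close>, since \<open>'i\<close> is infinite.
\<close>

locale ultrafinite_summability_space = summability_space scale S
  for scale :: "'k::field \<Rightarrow> 'v::ab_group_add \<Rightarrow> 'v" (infixr \<open>*s\<close> 75)
    and S :: "'i::infinite set \<Rightarrow> ('i \<Rightarrow> 'v) \<Rightarrow> 'v option" +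
  assumes UF: "\<And>I v (X :: 'i \<Rightarrow> 'i set) (f :: 'i \<Rightarrow> 'i \<Rightarrow> 'k).
    v \<in> dom (S I) \<Longrightarrow> (\<And>i. i \<in> I \<Longrightarrow> finite (X i)) \<Longrightarrow>
    summable_over S (Sigma I X) (\<lambda>(i, x). f i x *s v i)"


locale summability_algebra = summability_space scale S
  for scale :: "'k::field \<Rightarrow> 'a::ring \<Rightarrow> 'a" (infixr \<open>*s\<close> 75)
    and S :: "'i::infinite set \<Rightarrow> ('i \<Rightarrow> 'a) \<Rightarrow> 'a option" +
  assumes scale_mult_left: "\<And>c a b. (c *s a) * b = c *s (a * b)"
    and scale_mult_right: "\<And>c a b. a * (c *s b) = c *s (a * b)"
    and summable_mult: "\<And>a b I J. a \<in> dom (S I) \<Longrightarrow> b \<in> dom (S J) \<Longrightarrow>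
      summable_over S (I \<times> J) (\<lambda>(i, j). a i * b j)"
    and sum_mult: "\<And>a b I J. a \<in> dom (S I) \<Longrightarrow> b \<in> dom (S J) \<Longrightarrow>
      sum_over S (I \<times> J) (\<lambda>(i, j). a i * b j) = the (S I a) * the (S J b)"
begin

definition closed_ideal :: "'a set \<Rightarrow> bool" where
  "closed_ideal N \<longleftrightarrow>
     closed_subspace N \<and> (\<forall>a. \<forall>x\<in>N. a * x \<in> N \<and> x * a \<in> N)"

end

text \<open>
  The sort \<open>{ring, monoid_mult}\<close> is that of unital rings, without the requirement \<open>0 \<noteq> 1\<close> of
  \<open>ring_1\<close>. The set \<open>lists J\<close> consists of the finite words over \<open>J\<close>, including the empty one.
\<close>

locale summability_algebra_with_evaluations =
  summability_algebra scale S + ultrafinite_summability_space scale S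
  for scale :: "'k::field \<Rightarrow> 'a::{ring,monoid_mult} \<Rightarrow> 'a" (infixr \<open>*s\<close> 75)
    and S :: "'i::infinite set \<Rightarrow> ('i \<Rightarrow> 'a) \<Rightarrow> 'a option" +
  fixes \<mm> :: "'a set"
  assumes closed_ideal_max: "closed_ideal \<mm>"
    and unit_plus_max: "UNIV = {c *s 1 + x | c x. x \<in> \<mm>}"
    and summable_words: "f \<in> dom (S J) \<Longrightarrow> (\<And>j. j \<in> J \<Longrightarrow> f j \<in> \<mm>) \<Longrightarrow>
      summable_over S (lists J) (\<lambda>\<theta>. prod_list (map f \<theta>))"


definition summability_exp ::
    "('k::field_char_0 \<Rightarrow> 'a::{ring,monoid_mult} \<Rightarrow> 'a) \<Rightarrow>
     ('i set \<Rightarrow> ('i \<Rightarrow> 'a) \<Rightarrow> 'a option) \<Rightarrow> 'a \<Rightarrow> 'a" where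
  "summability_exp scale S \<delta> = sum_over S (UNIV :: nat set) (\<lambda>n. scale (1 / fact n) (\<delta> ^ n))"

text \<open>
  The formal power series \<open>X\<^sub>0 * X\<^sub>1\<close> is given by its coefficients on words in the letters \<open>0\<close>
  and \<open>1\<close>. A list \<open>[(m\<^sub>1, p\<^sub>1), \<dots>, (m\<^sub>n, p\<^sub>n)]\<close> stands for the monomial
  \<open>X\<^sub>0^m\<^sub>1 X\<^sub>1^p\<^sub>1 \<cdots> X\<^sub>0^m\<^sub>n X\<^sub>1^p\<^sub>n\<close>, and the coefficient of a word collects the contributions of
  all lists whose monomial is that word.
\<close>

definition block_word :: "(nat \<times> nat) list \<Rightarrow> nat list" where
  "block_word bs = concat (map (\<lambda>(m, p). replicate m 0 @ replicate p 1) bs)"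

definition bch_blocks :: "nat list \<Rightarrow> (nat \<times> nat) list set" where
  "bch_blocks \<theta> = {bs. length bs \<ge> 1 \<and> (\<forall>(m, p)\<in>set bs. m + p \<ge> 1) \<and> block_word bs = \<theta>}"

definition bch_coeff :: "nat list \<Rightarrow> 'k::field_char_0" where
  "bch_coeff \<theta> = (\<Sum>bs\<in>bch_blocks \<theta>.
     (-1) ^ (length bs + 1) / of_nat (length bs) *
     (1 / prod_list (map (\<lambda>(m, p). fact m * fact p) bs)))"

lemma finite_bch_blocks: "finite (bch_blocks \<theta>)"
proof -
  have len: "length (block_word bs) = sum_list (map (\<lambda>(m, p). m + p) bs)" for bs
    by (induction bs) (auto simp: block_word_def)
  have "length bs \<le> sum_list (map (\<lambda>(m, p). m + p) bs)"
    if "\<forall>(m, p)\<in>set bs. m + p \<ge> 1" for bs :: "(nat \<times> nat) list"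
    using that by (induction bs) auto
  moreover have "m + p \<le> sum_list (map (\<lambda>(m, p). m + p) bs)"
    if "(m, p) \<in> set bs" for m p and bs :: "(nat \<times> nat) list"
    using that by (induction bs) auto
  ultimately have "bch_blocks \<theta> \<subseteq>
      {bs. set bs \<subseteq> {..length \<theta>} \<times> {..length \<theta>} \<and> length bs \<le> length \<theta>}"
    unfolding bch_blocks_def by (force simp: len)
  then show ?thesis
    by (rule finite_subset) (simp add: finite_lists_length_le)
qed

definition bch_star ::
    "('k::field_char_0 \<Rightarrow> 'a::{ring,monoid_mult} \<Rightarrow> 'a) \<Rightarrow>
     ('i set \<Rightarrow> ('i \<Rightarrow> 'a) \<Rightarrow> 'a option) \<Rightarrow> 'a \<Rightarrow> 'a \<Rightarrow> 'a" where
  "bch_star scale S \<delta>1 \<delta>2 = sum_over S (lists {0, 1})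
     (\<lambda>\<theta>. scale (bch_coeff \<theta>) (prod_list (map (\<lambda>l. if l = 0 then \<delta>1 else \<delta>2) \<theta>)))"

end

theory Submission
  imports Defs "HOL-Library.Countable" "HOL-Computational_Algebra.Formal_Power_Series"
begin

text \<open>
  The definition of \<open>\<delta>1 * \<delta>2\<close> is the expansion of \<open>log (exp \<delta>1 \<cdot> exp \<delta>2)\<close>, so the theorem
  says that \<open>exp (log (1 + y)) = 1 + y\<close> for \<open>y = exp \<delta>1 \<cdot> exp \<delta>2 - 1 \<in> \<mm>\<close>. Two facts have to be
  shown: that \<open>\<delta>1 * \<delta>2\<close> really is the sum \<open>\<Sum>\<^sub>n (-1)\<^sup>n\<^sup>+\<^sup>1/n y\<^sup>n\<close> (lemma \<open>bch_star_eq_log\<close>), and the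
  identity for \<open>exp\<close> and \<open>log\<close> itself (lemma \<open>exp_log\<close>).

  Both follow from one principle. Let \<open>y = \<Sum>\<^sub>k a\<^sub>k\<close> be the sum of a summable family in \<open>\<mm>\<close>. The
  products of the \<open>a\<^sub>k\<close> along all finite words of indices form a summable family, and by
  ultrafiniteness it stays summable when each word \<open>\<theta>\<close> is weighted by \<open>w (length \<theta>)\<close>. Grouping the
  words by length turns the sum into the power series \<open>\<Sum>\<^sub>n w\<^sub>n y\<^sup>n\<close>
  (\<open>has_sum_over_power_series_words\<close>). If the \<open>a\<^sub>k\<close> are scalar multiples of monomials, then so are
  their products, and the same sum may be grouped by monomials instead, where the coefficient of
  each monomial is a finite sum of scalars (\<open>has_sum_over_regroup\<close>). Comparing the two groupings
  gives both facts.

  For \<open>bch_star_eq_log\<close> the indices are the pairs \<open>(m, p) \<noteq> (0, 0)\<close>, the family is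
  \<open>\<delta>1\<^sup>m \<delta>2\<^sup>p / (m! p!)\<close>, the weights are those of the logarithm, and the coefficients that appear
  are those of the Baker-Campbell-Hausdorff series by their definition. For \<open>exp_log\<close> the family
  consists of the terms of \<open>log (1 + y)\<close>, the weights are those of the exponential, and the
  coefficients that appear are those of the composition of the formal power series \<open>exp\<close> and
  \<open>log (1 + X)\<close> in one variable, which is \<open>1 + X\<close>.
\<close>

section \<open>Summable families over arbitrary index sets\<close>

context summability_space
begin

text \<open>
  Combining summability with the value of the sum, so that the axioms can be used as rules. The
  index set may have any type; if it does not embed into \<open>'i\<close> then no family on it has a sum.
\<close>

definition has_sum_over :: "'b set \<Rightarrow> ('b \<Rightarrow> 'v) \<Rightarrow> 'v \<Rightarrow> bool" where
  "has_sum_over K v s \<longleftrightarrow> transport S K v = Some s"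

lemma sum_over_eqI: "has_sum_over K v s \<Longrightarrow> sum_over S K v = s"
  by (simp add: has_sum_over_def sum_over_def)

lemma summable_overE:
  assumes "summable_over S K v"
  obtains s where "has_sum_over K v s"
  using assms by (auto simp: summable_over_def has_sum_over_def)

lemma has_sum_over_unique: "has_sum_over K v s \<Longrightarrow> has_sum_over K v t \<Longrightarrow> s = t"
  by (simp add: has_sum_over_def)

lemma has_sum_over_inj:
  fixes v :: "'b \<Rightarrow> 'v"
  assumes "has_sum_over K v s"
  obtains \<phi> :: "'b \<Rightarrow> 'i" where "inj_on \<phi> K"
  using assms by (auto simp: has_sum_over_def transport_def split: if_splits)

lemma has_sum_over_iff:
  fixes \<phi> :: "'b \<Rightarrow> 'i"
  assumes "inj_on \<phi> K"
  shows "has_sum_over K v s \<longleftrightarrow> S (\<phi> ` K) (v \<circ> inv_into K \<phi>) = Some s"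
  by (simp add: has_sum_over_def transport_eq[OF assms])

lemma has_sum_over_cong:
  fixes v w :: "'b \<Rightarrow> 'v"
  assumes "\<And>k. k \<in> K \<Longrightarrow> v k = w k"
  shows "has_sum_over K v s \<longleftrightarrow> has_sum_over K w s"
proof (cases "\<exists>\<phi> :: 'b \<Rightarrow> 'i. inj_on \<phi> K")
  case True
  then obtain \<phi> :: "'b \<Rightarrow> 'i" where \<phi>: "inj_on \<phi> K" by blast
  have "S (\<phi> ` K) (v \<circ> inv_into K \<phi>) = S (\<phi> ` K) (w \<circ> inv_into K \<phi>)"
    by (rule family_cong) (use \<phi> assms in auto)
  then show ?thesis by (simp add: has_sum_over_iff[OF \<phi>])
next
  case False
  then show ?thesis by (auto elim: has_sum_over_inj)
qed

lemma has_sum_over_reindex: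
  fixes \<phi> :: "'b \<Rightarrow> 'c"
  assumes bij: "bij_betw \<phi> K L" and sum: "has_sum_over L v s"
  shows "has_sum_over K (\<lambda>k. v (\<phi> k)) s"
proof -
  obtain \<psi> :: "'c \<Rightarrow> 'i" where \<psi>: "inj_on \<psi> L"
    using has_sum_over_inj[OF sum] .
  have L: "L = \<phi> ` K" and \<phi>: "inj_on \<phi> K"
    using bij by (auto simp: bij_betw_def)
  have inj: "inj_on (\<psi> \<circ> \<phi>) K"
    using \<phi> \<psi> by (simp add: L comp_inj_on)
  have inv: "inv_into K (\<psi> \<circ> \<phi>) (\<psi> (\<phi> k)) = k" if "k \<in> K" for k
    using inv_into_f_f[OF inj that] by simp
  have "S (\<psi> ` L) (v \<circ> inv_into L \<psi>) =
      S ((\<psi> \<circ> \<phi>) ` K) ((\<lambda>k. v (\<phi> k)) \<circ> inv_into K (\<psi> \<circ> \<phi>))"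
    unfolding L image_comp[symmetric]
    by (rule family_cong) (use \<psi> inv in \<open>auto simp: L\<close>)
  then show ?thesis
    using sum by (simp add: has_sum_over_iff[OF \<psi>] has_sum_over_iff[OF inj])
qed

text \<open>
  The form in which a family over an arbitrary set is handed to an axiom, all of which speak of
  families over subsets of \<open>'i\<close>.
\<close>

lemma has_sum_over_carrier:
  fixes v :: "'b \<Rightarrow> 'v"
  assumes "has_sum_over K v s"
  obtains \<phi> :: "'b \<Rightarrow> 'i"
  where "inj_on \<phi> K" "S (\<phi> ` K) (v \<circ> inv_into K \<phi>) = Some s"
proof -
  obtain \<phi> :: "'b \<Rightarrow> 'i" where "inj_on \<phi> K"
    using has_sum_over_inj[OF assms] .
  then show ?thesis
    using that assms by (simp add: has_sum_over_iff)
qed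

lemma ex_inj_countable: "\<exists>\<phi> :: 'b::countable \<Rightarrow> 'i. inj \<phi>"
proof -
  obtain f :: "nat \<Rightarrow> 'i" where "inj f"
    using infinite_UNIV infinite_countable_subset by blast
  then have "inj (f \<circ> (to_nat :: 'b \<Rightarrow> nat))"
    by (simp add: inj_compose)
  then show ?thesis by blast
qed

lemma has_sum_over_finite_support:
  fixes v :: "'b::countable \<Rightarrow> 'v"
  assumes "finite F" "F \<subseteq> K" "\<And>k. k \<in> K - F \<Longrightarrow> v k = 0"
  shows "has_sum_over K v (\<Sum>k\<in>F. v k)"
proof -
  obtain \<phi> :: "'b \<Rightarrow> 'i" where "inj \<phi>"
    using ex_inj_countable by blast
  then have \<phi>: "inj_on \<phi> K" by (rule inj_on_subset) simp
  let ?w = "v \<circ> inv_into K \<phi>"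
  have supp: "{i \<in> \<phi> ` K. ?w i \<noteq> 0} = \<phi> ` {k \<in> F. v k \<noteq> 0}"
    using assms(2,3) \<phi> by (auto, blast)
  have "S (\<phi> ` K) ?w = Some (\<Sum>i\<in>\<phi> ` {k \<in> F. v k \<noteq> 0}. ?w i)"
    unfolding supp[symmetric] by (rule SS1) (simp only: supp, use assms(1) in simp)
  also have "(\<Sum>i\<in>\<phi> ` {k \<in> F. v k \<noteq> 0}. ?w i) = (\<Sum>k\<in>{k \<in> F. v k \<noteq> 0}. ?w (\<phi> k))"
    by (rule sum.reindex_cong[of \<phi>]) (use \<open>inj \<phi>\<close> in \<open>auto intro: inj_on_subset\<close>)
  also have "\<dots> = (\<Sum>k\<in>{k \<in> F. v k \<noteq> 0}. v k)"
    by (rule sum.cong) (use assms \<phi> in auto)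
  also have "\<dots> = (\<Sum>k\<in>F. v k)"
    by (rule sum.mono_neutral_left) (use assms in auto)
  finally show ?thesis by (simp add: has_sum_over_iff[OF \<phi>] comp_def)
qed

lemma has_sum_over_finite:
  fixes v :: "'b::countable \<Rightarrow> 'v"
  assumes "finite K"
  shows "has_sum_over K v (\<Sum>k\<in>K. v k)"
  using has_sum_over_finite_support[of K K v] assms by simp

lemma has_sum_over_scale:
  fixes v :: "'b \<Rightarrow> 'v"
  assumes "has_sum_over K v s"
  shows "has_sum_over K (\<lambda>k. c *s v k) (c *s s)"
proof -
  obtain \<phi> :: "'b \<Rightarrow> 'i"
    where \<phi>: "inj_on \<phi> K" "S (\<phi> ` K) (v \<circ> inv_into K \<phi>) = Some s"
    using has_sum_over_carrier[OF assms] .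
  then have "v \<circ> inv_into K \<phi> \<in> dom (S (\<phi> ` K))" by auto
  from dom_scale[OF this, of c] sum_scale[OF this, of c] \<phi>
  show ?thesis by (auto simp: has_sum_over_iff[OF \<phi>(1)] comp_def)
qed

text \<open>
  Summation by parts of a partition (SS3), with the partition given by the fibres of a map. The
  target has a countable type so that it can be moved into \<open>'i\<close> even where fibres are empty.
\<close>

lemma has_sum_over_fibres:
  fixes v :: "'b \<Rightarrow> 'v" and h :: "'b \<Rightarrow> 'm::countable"
  assumes sum: "has_sum_over K v s" and h: "\<And>k. k \<in> K \<Longrightarrow> h k \<in> M"
  obtains t where "\<And>m. m \<in> M \<Longrightarrow> has_sum_over {k \<in> K. h k = m} v (t m)"
    and "has_sum_over M t s"
proof -
  obtain \<phi> :: "'b \<Rightarrow> 'i"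
    where \<phi>: "inj_on \<phi> K" and s: "S (\<phi> ` K) (v \<circ> inv_into K \<phi>) = Some s"
    using has_sum_over_carrier[OF sum] .
  obtain \<psi> :: "'m \<Rightarrow> 'i" where inj: "inj \<psi>"
    using ex_inj_countable by blast
  then have \<psi>: "inj_on \<psi> M" by (rule inj_on_subset) simp
  define B where "B j = \<phi> ` {k \<in> K. \<psi> (h k) = j}" for j
  define w where "w = v \<circ> inv_into K \<phi>"
  have disj: "disjoint_family_on B (\<psi> ` M)"
    unfolding disjoint_family_on_def B_def
    using \<phi> by (auto simp: inj_on_eq_iff)
  have un: "\<phi> ` K = (\<Union>j\<in>\<psi> ` M. B j)"
    using h by (auto simp: B_def)
  have dom: "w \<in> dom (S (\<phi> ` K))"
    using s by (auto simp: w_def)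
  define t where "t m = the (S (B (\<psi> m)) w)" for m
  have "has_sum_over {k \<in> K. h k = m} v (t m)" if "m \<in> M" for m
  proof -
    have fib: "{k \<in> K. \<psi> (h k) = \<psi> m} = {k \<in> K. h k = m}"
      using inj by (simp add: inj_eq)
    have inj': "inj_on \<phi> {k \<in> K. h k = m}"
      using \<phi> by (rule inj_on_subset) auto
    have "S (\<phi> ` {k \<in> K. h k = m}) (v \<circ> inv_into {k \<in> K. h k = m} \<phi>) = S (B (\<psi> m)) w"
      unfolding B_def fib
      by (rule family_cong) (use \<phi> inj' in \<open>auto simp: w_def\<close>)
    also have "\<dots> = Some (t m)"
      using SS3_parts[OF disj un dom, of "\<psi> m"] that by (auto simp: t_def)
    finally show ?thesis by (simp add: has_sum_over_iff[OF inj'])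
  qed
  moreover have "has_sum_over M t s"
  proof -
    have "S (\<psi> ` M) (t \<circ> inv_into M \<psi>) = S (\<psi> ` M) (\<lambda>j. the (S (B j) w))"
      by (rule family_cong) (use \<psi> in \<open>auto simp: t_def\<close>)
    also have "\<dots> = Some s"
      using SS3_dom[OF disj un dom] SS3_sum[OF disj un dom] s by (auto simp: w_def)
    finally show ?thesis by (simp add: has_sum_over_iff[OF \<psi>])
  qed
  ultimately show ?thesis using that by blast
qed

text \<open>
  Splitting off one term is summation over the two fibres of the map that tells this index apart.
\<close>

lemma has_sum_over_remove:
  fixes v :: "'b::countable \<Rightarrow> 'v"
  assumes sum: "has_sum_over K v s" and "k \<in> K"
  shows "has_sum_over (K - {k}) v (s - v k)"
proof -
  obtain t where t: "\<And>b. has_sum_over {l \<in> K. (l = k) = b} v (t b)"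
    and s: "has_sum_over UNIV t s"
    using has_sum_over_fibres[OF sum, of "\<lambda>l. l = k" UNIV] by auto
  have "{l \<in> K. (l = k) = True} = {k}"
    using \<open>k \<in> K\<close> by auto
  then have "t True = v k"
    using t[of True] has_sum_over_finite[of "{k}" v] has_sum_over_unique by auto
  moreover have "s = t True + t False"
    using s has_sum_over_finite[of UNIV t] has_sum_over_unique by (auto simp: UNIV_bool add.commute)
  moreover have "{l \<in> K. (l = k) = False} = K - {k}" by auto
  ultimately show ?thesis using t[of False] by simp
qed

text \<open>
  Collecting equal monomials: a term of the family is a coefficient times the monomial \<open>e (h k)\<close>,
  and each monomial occurs only finitely often, so that its coefficients can be added as scalars.
\<close>

lemma has_sum_over_regroup:
  fixes c :: "'b::countable \<Rightarrow> 'k" and e :: "'m::countable \<Rightarrow> 'v"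
  assumes sum: "has_sum_over K (\<lambda>k. c k *s e (h k)) s"
    and h: "\<And>k. k \<in> K \<Longrightarrow> h k \<in> M"
    and fin: "\<And>m. m \<in> M \<Longrightarrow> finite {k \<in> K. h k = m}"
  shows "has_sum_over M (\<lambda>m. (\<Sum>k\<in>{k \<in> K. h k = m}. c k) *s e m) s"
proof -
  obtain t where t: "\<And>m. m \<in> M \<Longrightarrow> has_sum_over {k \<in> K. h k = m} (\<lambda>k. c k *s e (h k)) (t m)"
    and s: "has_sum_over M t s"
    using has_sum_over_fibres[OF sum, of h M] h by blast
  have "t m = (\<Sum>k\<in>{k \<in> K. h k = m}. c k) *s e m" if "m \<in> M" for m
  proof -
    have "t m = (\<Sum>k\<in>{k \<in> K. h k = m}. c k *s e (h k))"
      using has_sum_over_unique[OF t[OF that] has_sum_over_finite[OF fin[OF that]]] .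
    also have "\<dots> = (\<Sum>k\<in>{k \<in> K. h k = m}. c k *s e m)"
      by (rule sum.cong) auto
    finally show ?thesis by (simp add: scale_sum_left)
  qed
  then show ?thesis
    using has_sum_over_cong[of M t "\<lambda>m. (\<Sum>k\<in>{k \<in> K. h k = m}. c k) *s e m"] s by blast
qed

lemma closed_subspace_sum:
  fixes v :: "'b \<Rightarrow> 'v"
  assumes "closed_subspace W" "has_sum_over K v s" "\<And>k. k \<in> K \<Longrightarrow> v k \<in> W"
  shows "s \<in> W"
proof -
  obtain \<phi> :: "'b \<Rightarrow> 'i"
    where \<phi>: "inj_on \<phi> K" and s: "S (\<phi> ` K) (v \<circ> inv_into K \<phi>) = Some s"
    using has_sum_over_carrier[OF assms(2)] .
  have "v \<circ> inv_into K \<phi> \<in> dom (S (\<phi> ` K))" using s by auto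
  moreover have "\<forall>i\<in>\<phi> ` K. (v \<circ> inv_into K \<phi>) i \<in> W" using \<phi> assms(3) by auto
  ultimately have "the (S (\<phi> ` K) (v \<circ> inv_into K \<phi>)) \<in> W"
    using assms(1) unfolding closed_subspace_def by blast
  then show ?thesis by (simp add: s)
qed

end

text \<open>
  Arbitrary coefficients may be put in front of the terms: this is (UF) with one-element sets.
\<close>

lemma (in ultrafinite_summability_space) has_sum_over_coeffs:
  fixes v :: "'b \<Rightarrow> 'v"
  assumes "has_sum_over K v s"
  obtains t where "has_sum_over K (\<lambda>k. c k *s v k) t"
proof -
  obtain \<phi> :: "'b \<Rightarrow> 'i"
    where \<phi>: "inj_on \<phi> K" and s: "S (\<phi> ` K) (v \<circ> inv_into K \<phi>) = Some s"
    using has_sum_over_carrier[OF assms] .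
  have "summable_over S (Sigma (\<phi> ` K) (\<lambda>i. {i}))
      (\<lambda>(i, x). c (inv_into K \<phi> i) *s (v \<circ> inv_into K \<phi>) i)"
    by (rule UF) (auto simp: domIff s simp del: comp_apply)
  then obtain t where t: "has_sum_over (Sigma (\<phi> ` K) (\<lambda>i. {i}))
      (\<lambda>(i, x). c (inv_into K \<phi> i) *s (v \<circ> inv_into K \<phi>) i) t"
    by (rule summable_overE)
  have "bij_betw (\<lambda>k. (\<phi> k, \<phi> k)) K (Sigma (\<phi> ` K) (\<lambda>i. {i}))"
    using \<phi> by (auto simp: bij_betw_def inj_on_def)
  from has_sum_over_reindex[OF this t]
  have "has_sum_over K (\<lambda>k. c k *s v k) t"
    by (rule has_sum_over_cong[THEN iffD1, rotated]) (use \<phi> in auto)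
  then show ?thesis by (rule that)
qed

lemma (in summability_algebra) has_sum_over_mult:
  fixes v :: "'b \<Rightarrow> 'a" and w :: "'c \<Rightarrow> 'a"
  assumes "has_sum_over K v s" "has_sum_over L w t"
  shows "has_sum_over (K \<times> L) (\<lambda>(k, l). v k * w l) (s * t)"
proof -
  obtain \<phi> :: "'b \<Rightarrow> 'i"
    where \<phi>: "inj_on \<phi> K" and s: "S (\<phi> ` K) (v \<circ> inv_into K \<phi>) = Some s"
    using has_sum_over_carrier[OF assms(1)] .
  obtain \<psi> :: "'c \<Rightarrow> 'i"
    where \<psi>: "inj_on \<psi> L" and t: "S (\<psi> ` L) (w \<circ> inv_into L \<psi>) = Some t"
    using has_sum_over_carrier[OF assms(2)] .
  let ?f = "\<lambda>(i, j). (v \<circ> inv_into K \<phi>) i * (w \<circ> inv_into L \<psi>) j"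
  have dom: "v \<circ> inv_into K \<phi> \<in> dom (S (\<phi> ` K))" "w \<circ> inv_into L \<psi> \<in> dom (S (\<psi> ` L))"
    using s t by auto
  have "has_sum_over (\<phi> ` K \<times> \<psi> ` L) ?f (s * t)"
    using summable_mult[OF dom] sum_mult[OF dom] s t
    by (auto simp: summable_over_def sum_over_def has_sum_over_def)
  moreover have "bij_betw (map_prod \<phi> \<psi>) (K \<times> L) (\<phi> ` K \<times> \<psi> ` L)"
    using \<phi> \<psi> by (simp add: bij_betw_def map_prod_inj_on map_prod_surj_on)
  ultimately have "has_sum_over (K \<times> L) (\<lambda>k. ?f (map_prod \<phi> \<psi> k)) (s * t)"
    by (rule has_sum_over_reindex[rotated])
  then show ?thesis
    by (rule has_sum_over_cong[THEN iffD1, rotated]) (use \<phi> \<psi> in auto)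
qed

section \<open>Sums over words\<close>

context summability_algebra_with_evaluations
begin

lemma max_closed: "closed_subspace \<mm>"
  using closed_ideal_max by (simp add: closed_ideal_def)

lemma max_subspace: "subspace \<mm>"
  using max_closed by (simp add: closed_subspace_def)

lemma max_mult_left: "x \<in> \<mm> \<Longrightarrow> a * x \<in> \<mm>"
  and max_mult_right: "x \<in> \<mm> \<Longrightarrow> x * a \<in> \<mm>"
  using closed_ideal_max by (auto simp: closed_ideal_def)

lemma max_power:
  assumes "x \<in> \<mm>" "n \<noteq> 0"
  shows "x ^ n \<in> \<mm>"
  using assms by (cases n) (auto intro: max_mult_right)

lemma has_sum_over_words:
  fixes a :: "'b \<Rightarrow> 'a"
  assumes "has_sum_over K a y" "\<And>k. k \<in> K \<Longrightarrow> a k \<in> \<mm>"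
  obtains s where "has_sum_over (lists K) (\<lambda>\<theta>. prod_list (map a \<theta>)) s"
proof -
  obtain \<phi> :: "'b \<Rightarrow> 'i"
    where \<phi>: "inj_on \<phi> K" and y: "S (\<phi> ` K) (a \<circ> inv_into K \<phi>) = Some y"
    using has_sum_over_carrier[OF assms(1)] .
  have "summable_over S (lists (\<phi> ` K)) (\<lambda>\<theta>. prod_list (map (a \<circ> inv_into K \<phi>) \<theta>))"
    by (rule summable_words) (use y \<phi> assms(2) in auto)
  then obtain s where
    s: "has_sum_over (lists (\<phi> ` K)) (\<lambda>\<theta>. prod_list (map (a \<circ> inv_into K \<phi>) \<theta>)) s"
    by (rule summable_overE)
  have "bij_betw (map \<phi>) (lists K) (lists (\<phi> ` K))"
    using \<phi> by (simp add: bij_betw_def inj_on_map_lists lists_image)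
  from has_sum_over_reindex[OF this s]
  have "has_sum_over (lists K) (\<lambda>\<theta>. prod_list (map a \<theta>)) s"
  proof (rule has_sum_over_cong[THEN iffD1, rotated])
    fix \<theta> assume "\<theta> \<in> lists K"
    then have "map (a \<circ> inv_into K \<phi>) (map \<phi> \<theta>) = map a \<theta>"
      using \<phi> by (auto simp: in_lists_conv_set)
    then show "prod_list (map (a \<circ> inv_into K \<phi>) (map \<phi> \<theta>)) = prod_list (map a \<theta>)"
      by (rule arg_cong)
  qed
  then show ?thesis by (rule that)
qed

text \<open>
  This is the distributive law for the \<open>n\<close>-th power of an infinite sum; splitting off the first
  letter reduces it to the product axiom.
\<close>

lemma has_sum_over_words_of_length:
  fixes a :: "'b::countable \<Rightarrow> 'a"
  assumes "has_sum_over K a y"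
  shows "has_sum_over {\<theta> \<in> lists K. length \<theta> = n} (\<lambda>\<theta>. prod_list (map a \<theta>)) (y ^ n)"
proof (induction n)
  case 0
  have "{\<theta> \<in> lists K. length \<theta> = 0} = {[]}" by auto
  then show ?case
    using has_sum_over_finite[of "{[]}" "\<lambda>\<theta>. prod_list (map a \<theta>)"] by simp
next
  case (Suc n)
  let ?W = "\<lambda>n. {\<theta> \<in> lists K. length \<theta> = n}"
  have "bij_betw (\<lambda>\<theta>. (hd \<theta>, tl \<theta>)) (?W (Suc n)) (K \<times> ?W n)"
    by (rule bij_betw_byWitness[of _ "\<lambda>(k, \<theta>). k # \<theta>"]) (auto simp: length_Suc_conv)
  from has_sum_over_reindex[OF this has_sum_over_mult[OF assms Suc.IH]]
  have "has_sum_over (?W (Suc n)) (\<lambda>\<theta>. a (hd \<theta>) * prod_list (map a (tl \<theta>))) (y ^ Suc n)"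
    by simp
  then show ?case
    by (rule has_sum_over_cong[THEN iffD1, rotated]) (auto simp: length_Suc_conv)
qed

text \<open>
  Substituting the sum \<open>y\<close> of a family into a power series and multiplying out: the words over the
  index set are grouped by length.
\<close>

lemma has_sum_over_power_series_words:
  fixes a :: "'b::countable \<Rightarrow> 'a"
  assumes y: "has_sum_over K a y" and a: "\<And>k. k \<in> K \<Longrightarrow> a k \<in> \<mm>"
  obtains s where "has_sum_over (lists K) (\<lambda>\<theta>. w (length \<theta>) *s prod_list (map a \<theta>)) s"
    and "has_sum_over UNIV (\<lambda>n. w n *s y ^ n) s"
proof -
  let ?f = "\<lambda>\<theta>. w (length \<theta>) *s prod_list (map a \<theta>)"
  obtain s0 where "has_sum_over (lists K) (\<lambda>\<theta>. prod_list (map a \<theta>)) s0"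
    using has_sum_over_words[OF y a] by blast
  then obtain s where s: "has_sum_over (lists K) ?f s"
    by (rule has_sum_over_coeffs)
  obtain t where t: "\<And>n. has_sum_over {\<theta> \<in> lists K. length \<theta> = n} ?f (t n)"
    and st: "has_sum_over UNIV t s"
    using has_sum_over_fibres[OF s, of length UNIV] by auto
  have "t n = w n *s y ^ n" for n
  proof -
    have "has_sum_over {\<theta> \<in> lists K. length \<theta> = n} ?f (w n *s y ^ n)"
      using has_sum_over_scale[OF has_sum_over_words_of_length[OF y]]
      by (rule has_sum_over_cong[THEN iffD1, rotated]) auto
    with t show ?thesis by (rule has_sum_over_unique)
  qed
  then have "t = (\<lambda>n. w n *s y ^ n)" by blast
  then show ?thesis using that s st by blast
qed

lemma has_sum_over_power_series:
  assumes "y \<in> \<mm>"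
  obtains s where "has_sum_over (UNIV :: nat set) (\<lambda>n. w n *s y ^ n) s"
proof -
  \<comment> \<open>The words over a one-element set are the powers of its element.\<close>
  have "has_sum_over {()} (\<lambda>_. y) y"
    using has_sum_over_finite[of "{()}" "\<lambda>_. y"] by simp
  then show ?thesis
    using assms that by (rule has_sum_over_power_series_words)
qed

lemma scale_mult_scale: "(c *s a) * (d *s b) = (c * d) *s (a * b)"
  by (simp add: scale_mult_left scale_mult_right)

lemma prod_list_scale:
  "prod_list (map (\<lambda>j. c j *s b j) js) = prod_list (map c js) *s prod_list (map b js)"
  by (induction js) (simp_all add: scale_mult_scale)

end

section \<open>Coefficients of the exponential of the logarithm\<close>

lemma finite_positive_lists_sum: "finite {ns :: nat list. 0 \<notin> set ns \<and> sum_list ns = m}"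
proof -
  have len: "0 \<notin> set ns \<Longrightarrow> length ns \<le> sum_list ns" for ns :: "nat list"
    by (induction ns) auto
  show ?thesis
    by (rule finite_subset[OF _ finite_lists_length_le[of "{..m}" m]])
      (use len member_le_sum_list in \<open>fastforce\<close>, simp)
qed

text \<open>
  Since \<open>g\<close> has no constant term, only lists of positive exponents contribute. These are the
  compositions of \<open>m\<close>, so that there are finitely many even when the length is not fixed.
\<close>

lemma fps_power_nth_lists:
  fixes g :: "'k::field fps"
  assumes "fps_nth g 0 = 0"
  shows "fps_nth (g ^ n) m = (\<Sum>ns | 0 \<notin> set ns \<and> sum_list ns = m \<and> length ns = n.
    prod_list (map (fps_nth g) ns))"
proof (induction n arbitrary: m)
  case 0
  have "{ns :: nat list. 0 \<notin> set ns \<and> sum_list ns = m \<and> length ns = 0} = (if m = 0 then {[]} else {})"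
    by auto
  then show ?case by simp
next
  case (Suc n)
  let ?L = "\<lambda>m n. {ns :: nat list. 0 \<notin> set ns \<and> sum_list ns = m \<and> length ns = n}"
  have fin: "finite (?L m n)" for m n
    by (rule finite_subset[OF _ finite_positive_lists_sum[of m]]) auto
  have "fps_nth (g ^ Suc n) m = (\<Sum>i=0..m. fps_nth g i * (\<Sum>ns\<in>?L (m - i) n. prod_list (map (fps_nth g) ns)))"
    by (simp add: fps_mult_nth Suc.IH)
  also have "\<dots> = (\<Sum>i=1..m. fps_nth g i * (\<Sum>ns\<in>?L (m - i) n. prod_list (map (fps_nth g) ns)))"
    by (rule sum.mono_neutral_right) (use assms in \<open>auto simp: not_le\<close>)
  also have "\<dots> = (\<Sum>(i, ns)\<in>Sigma {1..m} (\<lambda>i. ?L (m - i) n). fps_nth g i * prod_list (map (fps_nth g) ns))"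
    by (simp add: sum_distrib_left sum.Sigma fin)
  also have "\<dots> = (\<Sum>ns\<in>?L m (Suc n). prod_list (map (fps_nth g) ns))"
    by (rule sum.reindex_bij_witness[of _ "\<lambda>ns. (hd ns, tl ns)" "\<lambda>(i, ns). i # ns"])
      (auto simp: length_Suc_conv)
  finally show ?case .
qed

text \<open>
  The coefficients of \<open>log (1 + X)\<close>, including the constant one: for \<open>n = 0\<close> the division by zero
  gives the correct value \<open>0\<close>.
\<close>

definition log_coeff :: "nat \<Rightarrow> 'k::field_char_0" where
  "log_coeff n = (-1) ^ (n + 1) / of_nat n"

lemma log_coeff_0 [simp]: "log_coeff 0 = 0"
  by (simp add: log_coeff_def)

text \<open>
  The left-hand side is the coefficient of \<open>X\<^sup>m\<close> in \<open>exp (log (1 + X)) = 1 + X\<close>, because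
  \<open>log (1 + X)\<close> is the compositional inverse of \<open>exp X - 1\<close>.
\<close>

lemma exp_log_coeff:
  "(\<Sum>ns | 0 \<notin> set ns \<and> sum_list ns = m.
      1 / fact (length ns) * prod_list (map log_coeff ns)) =
    (if m \<le> 1 then 1 else 0 :: 'k::field_char_0)"
proof -
  let ?L = "{ns :: nat list. 0 \<notin> set ns \<and> sum_list ns = m}"
  let ?g = "fps_ln 1 :: 'k fps"
  have g: "fps_nth ?g = log_coeff"
    by (rule ext) (simp add: fps_ln_nth log_coeff_def power_eq_if)
  have pow: "fps_nth (?g ^ n) m = (\<Sum>ns | 0 \<notin> set ns \<and> sum_list ns = m \<and> length ns = n.
      prod_list (map log_coeff ns))" for n
    using fps_power_nth_lists[of ?g n m] by (simp add: g)
  have len: "0 \<notin> set ns \<Longrightarrow> length ns \<le> sum_list ns" for ns :: "nat list"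
    by (induction ns) auto
  have "(\<Sum>ns\<in>?L. 1 / fact (length ns) * prod_list (map log_coeff ns)) =
      (\<Sum>n=0..m. \<Sum>ns\<in>{ns \<in> ?L. length ns = n}. 1 / fact (length ns) * prod_list (map log_coeff ns) :: 'k)"
    by (rule sum.group[symmetric]) (use len finite_positive_lists_sum in auto)
  also have "\<dots> = (\<Sum>n=0..m. 1 / fact n * fps_nth (?g ^ n) m)"
    by (intro sum.cong refl)
      (auto simp: pow sum_distrib_left conj_assoc intro!: sum.cong)
  also have "\<dots> = fps_nth (fps_compose (fps_exp 1) ?g) m"
    by (simp add: fps_compose_nth)
  also have "fps_compose (fps_exp 1) ?g = fps_compose (fps_exp 1 - 1) ?g + 1"
    by (simp add: fps_compose_sub_distrib)
  also have "fps_compose (fps_exp 1 - 1) ?g = fps_X"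
    by (simp add: fps_ln_fps_exp_inv fps_inv_right)
  also have "fps_nth (fps_X + 1) m = (if m \<le> 1 then 1 else 0 :: 'k)"
    by (auto simp: fps_X_def le_Suc_eq)
  finally show ?thesis .
qed

section \<open>Exponential, logarithm and the Baker-Campbell-Hausdorff series\<close>

locale summability_algebra_with_evaluations_char_0 =
  summability_algebra_with_evaluations scale S \<mm>
  for scale :: "'k::field_char_0 \<Rightarrow> 'a::{ring,monoid_mult} \<Rightarrow> 'a" (infixr \<open>*s\<close> 75)
    and S :: "'i::infinite set \<Rightarrow> ('i \<Rightarrow> 'a) \<Rightarrow> 'a option"
    and \<mm> :: "'a set"
begin

lemma has_sum_over_exp:
  assumes "y \<in> \<mm>"
  shows "has_sum_over UNIV (\<lambda>n. (1 / fact n) *s y ^ n) (summability_exp scale S y)"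
proof -
  obtain s where s: "has_sum_over (UNIV :: nat set) (\<lambda>n. (1 / fact n) *s y ^ n) s"
    using has_sum_over_power_series[OF assms, of "\<lambda>n. 1 / fact n"] by blast
  then show ?thesis
    unfolding summability_exp_def by (simp add: sum_over_eqI)
qed

lemma prod_list_powers: "prod_list (map (\<lambda>n. y ^ n) ns) = y ^ sum_list ns"
  for y :: 'a
  by (induction ns) (simp_all add: power_add)

text \<open>
  The exponential of the logarithm. The terms of \<open>log (1 + y)\<close> are multiplied out in \<open>exp z\<close>, and the
  products, which are indexed by lists of exponents, are collected by total exponent; this leads to
  the coefficients in \<open>exp_log_coeff\<close>. The constant term is removed first because only finitely many
  lists of positive exponents have a given sum.
\<close>

lemma exp_log:
  assumes "y \<in> \<mm>" and z: "has_sum_over UNIV (\<lambda>n. log_coeff n *s y ^ n) z"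
  shows "summability_exp scale S z = 1 + y"
proof -
  let ?K = "- {0} :: nat set"
  have "has_sum_over ?K (\<lambda>n. log_coeff n *s y ^ n) z"
    using has_sum_over_remove[OF z, of 0] by (simp add: Compl_eq_Diff_UNIV)
  moreover have "log_coeff n *s y ^ n \<in> \<mm>" if "n \<in> ?K" for n
    using that assms(1) by (intro subspace_scale[OF max_subspace] max_power) auto
  ultimately obtain s
    where words: "has_sum_over (lists ?K) (\<lambda>ns. (1 / fact (length ns)) *s
        prod_list (map (\<lambda>n. log_coeff n *s y ^ n) ns)) s"
      and exp: "has_sum_over UNIV (\<lambda>n. (1 / fact n) *s z ^ n) s"
    by (rule has_sum_over_power_series_words)
  from words have "has_sum_over (lists ?K)
      (\<lambda>ns. (1 / fact (length ns) * prod_list (map log_coeff ns)) *s y ^ sum_list ns) s"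
    by (simp add: prod_list_scale prod_list_powers)
  moreover have fibre: "{ns \<in> lists ?K. sum_list ns = m} =
      {ns. 0 \<notin> set ns \<and> sum_list ns = m}" for m
    by (auto simp: in_lists_conv_set intro: gr0I)
  ultimately have "has_sum_over UNIV (\<lambda>m. (\<Sum>ns\<in>{ns \<in> lists ?K. sum_list ns = m}.
      1 / fact (length ns) * prod_list (map log_coeff ns)) *s y ^ m) s"
    by (intro has_sum_over_regroup[where h = sum_list and e = "\<lambda>m. y ^ m"])
      (simp_all only: fibre finite_positive_lists_sum UNIV_I)
  then have s: "has_sum_over UNIV (\<lambda>m. (if m \<le> 1 then 1 else 0) *s y ^ m) s"
    by (simp only: fibre exp_log_coeff)
  have "has_sum_over UNIV (\<lambda>m. (if m \<le> 1 then 1 else 0) *s y ^ m)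
      (\<Sum>m\<in>{0, 1 :: nat}. (if m \<le> 1 then 1 else 0) *s y ^ m)"
    by (rule has_sum_over_finite_support) auto
  with s have "s = 1 + y"
    using has_sum_over_unique[of UNIV _ s "1 + y"] by simp
  with exp show ?thesis
    unfolding summability_exp_def by (simp add: sum_over_eqI)
qed

text \<open>
  Multiplying out \<open>log (1 + y)\<close>, where \<open>y\<close> is the sum of the non-constant terms of the double series
  \<open>exp \<delta>1 \<cdot> exp \<delta>2\<close>, gives products indexed by lists of pairs of exponents. Such a product is a
  multiple of the word in \<open>\<delta>1\<close> and \<open>\<delta>2\<close> that the list spells, and collecting the lists that spell
  the same word gives the coefficients of the Baker-Campbell-Hausdorff series.
\<close>

lemma bch_star_eq_log:
  assumes "\<delta>1 \<in> \<mm>" "\<delta>2 \<in> \<mm>"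
  defines "y \<equiv> summability_exp scale S \<delta>1 * summability_exp scale S \<delta>2 - 1"
  shows "y \<in> \<mm>"
    and "has_sum_over UNIV (\<lambda>n. log_coeff n *s y ^ n) (bch_star scale S \<delta>1 \<delta>2)"
proof -
  define K :: "(nat \<times> nat) set" where "K = UNIV - {(0, 0)}"
  define c :: "nat \<times> nat \<Rightarrow> 'k" where "c = (\<lambda>(m, p). 1 / (fact m * fact p))"
  define e where "e = (\<lambda>(m, p). \<delta>1 ^ m * \<delta>2 ^ p)"
  define word where "word = (\<lambda>\<theta>. prod_list (map (\<lambda>l. if l = (0::nat) then \<delta>1 else \<delta>2) \<theta>))"
  have "has_sum_over (UNIV \<times> UNIV)
      (\<lambda>(m, p). ((1 / fact m) *s \<delta>1 ^ m) * ((1 / fact p) *s \<delta>2 ^ p)) (y + 1)"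
    unfolding y_def using has_sum_over_mult[OF has_sum_over_exp has_sum_over_exp] assms by simp
  then have "has_sum_over UNIV (\<lambda>b. c b *s e b) (y + 1)"
    by (simp add: scale_mult_scale c_def e_def case_prod_unfold)
  then have y: "has_sum_over K (\<lambda>b. c b *s e b) y"
    using has_sum_over_remove[of UNIV "\<lambda>b. c b *s e b" "y + 1" "(0, 0)"]
    by (simp add: K_def c_def e_def)
  have m: "c b *s e b \<in> \<mm>" if "b \<in> K" for b
  proof -
    have "e b \<in> \<mm>"
      using that assms(1,2) by (cases b)
        (auto simp: K_def e_def intro: max_mult_left max_mult_right max_power)
    then show ?thesis by (rule subspace_scale[OF max_subspace])
  qed
  show "y \<in> \<mm>"
    using closed_subspace_sum[OF max_closed y m] .
  obtain z
    where words: "has_sum_over (lists K)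
        (\<lambda>bs. log_coeff (length bs) *s prod_list (map (\<lambda>b. c b *s e b) bs)) z"
      and z: "has_sum_over UNIV (\<lambda>n. log_coeff n *s y ^ n) z"
    using y m by (rule has_sum_over_power_series_words)
  have replicate: "word (replicate m 0 @ replicate p 1) = \<delta>1 ^ m * \<delta>2 ^ p" for m p
    by (simp add: word_def prod_list_replicate)
  have e_word: "prod_list (map e bs) = word (block_word bs)" for bs
    by (induction bs) (auto simp: block_word_def e_def replicate word_def prod_list_replicate mult.assoc)
  from words have "has_sum_over (lists K)
      (\<lambda>bs. (log_coeff (length bs) * prod_list (map c bs)) *s word (block_word bs)) z"
    by (simp add: prod_list_scale e_word)
  \<comment> \<open>The empty list spells the empty word but is not a list of blocks; its coefficient is zero.\<close>
  moreover have fibre: "{bs \<in> lists K. block_word bs = \<theta>} - {[]} = bch_blocks \<theta>" for \<theta>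
    by (auto simp: bch_blocks_def in_lists_conv_set K_def Suc_le_eq)
  then have fin: "finite {bs \<in> lists K. block_word bs = \<theta>}" for \<theta>
    using finite_bch_blocks[of \<theta>] by (simp flip: fibre)
  moreover have "block_word bs \<in> lists {0, 1}" for bs
    by (auto simp: block_word_def in_lists_conv_set)
  ultimately have "has_sum_over (lists {0, 1})
      (\<lambda>\<theta>. (\<Sum>bs\<in>{bs \<in> lists K. block_word bs = \<theta>}.
        log_coeff (length bs) * prod_list (map c bs)) *s word \<theta>) z"
    by (intro has_sum_over_regroup) auto
  moreover have "(\<Sum>bs\<in>{bs \<in> lists K. block_word bs = \<theta>}.
      log_coeff (length bs) * prod_list (map c bs)) = bch_coeff \<theta>" for \<theta>
  proof -
    have c: "prod_list (map c bs) = 1 / prod_list (map (\<lambda>(m, p). fact m * fact p) bs)" for bs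
      by (induction bs) (auto simp: c_def)
    have "(\<Sum>bs\<in>{bs \<in> lists K. block_word bs = \<theta>}. log_coeff (length bs) * prod_list (map c bs)) =
        (\<Sum>bs\<in>bch_blocks \<theta>. log_coeff (length bs) * prod_list (map c bs))"
      unfolding fibre[symmetric] by (rule sum.mono_neutral_right) (use fin in auto)
    then show ?thesis by (simp add: bch_coeff_def log_coeff_def c)
  qed
  ultimately have "bch_star scale S \<delta>1 \<delta>2 = z"
    by (simp add: bch_star_def sum_over_eqI word_def)
  with z show "has_sum_over UNIV (\<lambda>n. log_coeff n *s y ^ n) (bch_star scale S \<delta>1 \<delta>2)"
    by simp
qed

end

theorem corollary2p8:
  fixes scale :: "'k::field_char_0 \<Rightarrow> 'a::{ring,monoid_mult} \<Rightarrow> 'a"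
    and S :: "'i::infinite set \<Rightarrow> ('i \<Rightarrow> 'a) \<Rightarrow> 'a option"
    and \<mm> :: "'a set" and \<delta>1 \<delta>2 :: 'a
  assumes "summability_algebra_with_evaluations scale S \<mm>"
    and "\<delta>1 \<in> \<mm>" and "\<delta>2 \<in> \<mm>"
  shows "summability_exp scale S \<delta>1 * summability_exp scale S \<delta>2 =
         summability_exp scale S (bch_star scale S \<delta>1 \<delta>2)"
proof -
  interpret summability_algebra_with_evaluations_char_0 scale S \<mm>
    by (rule summability_algebra_with_evaluations_char_0.intro[OF assms(1)])
  have "summability_exp scale S (bch_star scale S \<delta>1 \<delta>2) =
      1 + (summability_exp scale S \<delta>1 * summability_exp scale S \<delta>2 - 1)"
    by (rule exp_log[OF bch_star_eq_log[OF assms(2,3)]])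
  then show ?thesis by simp
qed

end
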